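(* Let $1\le n<m\le N$, let $\Phi\in\mathbb R^{N\times m}$ be a basis matrix and $S\in\mathbb R^{N\times n}$ a selection matrix such that $S^\top\Phi$ has full rank $n$, and let $Z$ be a kernel matrix of $S^\top\Phi$. For every $\mathbf u\in\mathbb R^N$, the S-DEIM reconstruction $\tilde{\mathbf u}(\mathbf z)=\Phi(S^\top\Phi)^+S^\top\mathbf u+\Phi\mathbf z$ satisfies $$\|\tilde{\mathbf u}(\mathbf z)-\mathbf u\|\le\|(S^\top\Phi)^+\|_2\,\mathcal E_m(\mathbf u)+\|\mathbf z-\hat{\mathbf z}\|\qquad\text{for all }\mathbf z\in\mathcal N[S^\top\Phi],$$ where $\mathcal E_m(\mathbf u)=\|\hat{\mathbf u}-\mathbf u\|$ is the truncation error with $\hat{\mathbf u}=\Phi\Phi^\top\mathbf u$, and $\hat{\mathbf z}=ZZ^\top\Phi^\top\mathbf u$ is the optimal kernel vector.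
   Context: A basis matrix $\Phi\in\mathbb R^{N\times m}$ is a real matrix with orthonormal columns, $\Phi^\top\Phi=\mathbb I_m$. A selection matrix $S\in\mathbb R^{N\times n}$ is a matrix $[\mathbf e_{i_1}|\cdots|\mathbf e_{i_n}]$ whose columns are standard basis vectors of $\mathbb R^N$ with distinct indices. $A^+$ is the Moore--Penrose pseudoinverse of $A$, $\mathcal N[A]$ is its null space, $\|\cdot\|$ is the Euclidean norm of vectors and $\|\cdot\|_2$ is the spectral norm of matrices. A kernel matrix $Z\in\mathbb R^{m\times(m-n)}$ is a matrix whose columns form an orthonormal basis of $\mathcal N[S^\top\Phi]$. *)

theory Defs
  imports "HOL-Analysis.Analysis"
begin

text \<open>An $N \times m$ real matrix is a term of type \<^typ>\<open>real^'m^'N\<close>: the outermost index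
  type counts the rows.\<close>

definition null_space :: "real^'m^'n \<Rightarrow> (real^'m) set" where
  "null_space A = {x. A *v x = 0}"

definition spectral_norm :: "real^'m^'n \<Rightarrow> real" where
  "spectral_norm A = onorm (\<lambda>x. A *v x)"

definition basis_matrix :: "real^'m^'N \<Rightarrow> bool" where
  "basis_matrix \<Phi> \<longleftrightarrow> transpose \<Phi> ** \<Phi> = mat 1"

definition selection_matrix :: "real^'n^'N \<Rightarrow> bool" where
  "selection_matrix S \<longleftrightarrow> (\<exists>i :: 'n \<Rightarrow> 'N. inj i \<and> (\<forall>j. column j S = axis (i j) 1))"

text \<open>Orthonormality is stated for the indexed family of columns, since the set
  \<^const>\<open>columns\<close> would identify repeated columns.\<close>

definition kernel_matrix :: "real^'m^'n \<Rightarrow> real^'k^'m \<Rightarrow> bool" where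
  "kernel_matrix A Z \<longleftrightarrow>
     (\<forall>i j. column i Z \<bullet> column j Z = (if i = j then 1 else 0)) \<and>
     span (columns Z) = null_space A"

definition is_pseudoinverse :: "real^'m^'n \<Rightarrow> real^'n^'m \<Rightarrow> bool" where
  "is_pseudoinverse A X \<longleftrightarrow>
     A ** X ** A = A \<and> X ** A ** X = X \<and>
     transpose (A ** X) = A ** X \<and> transpose (X ** A) = X ** A"

definition pseudoinverse :: "real^'m^'n \<Rightarrow> real^'n^'m" where
  "pseudoinverse A = (THE X. is_pseudoinverse A X)"

lemma is_pseudoinverse_unique:
  assumes "is_pseudoinverse A X" "is_pseudoinverse A Y"
  shows "X = Y"
proof -
  have X: "A ** X ** A = A" "X ** A ** X = X" "transpose (A ** X) = A ** X" "transpose (X ** A) = X ** A"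
    and Y: "A ** Y ** A = A" "Y ** A ** Y = Y" "transpose (A ** Y) = A ** Y" "transpose (Y ** A) = Y ** A"
    using assms by (auto simp: is_pseudoinverse_def)
  have "A ** X = transpose ((A ** Y) ** (A ** X))"
    using X(3) Y(1) by (metis matrix_mul_assoc)
  also have "\<dots> = (A ** X) ** (A ** Y)"
    using X(3) Y(3) by (simp add: matrix_transpose_mul)
  also have "\<dots> = A ** Y"
    using X(1) by (simp add: matrix_mul_assoc)
  finally have AX: "A ** X = A ** Y" .
  have "X ** A = transpose ((X ** A) ** (Y ** A))"
    using X(4) Y(1) by (metis matrix_mul_assoc)
  also have "\<dots> = (Y ** A) ** (X ** A)"
    using X(4) Y(4) by (simp add: matrix_transpose_mul)
  also have "\<dots> = Y ** A"
    using X(1) by (metis matrix_mul_assoc)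
  finally have "X ** A = Y ** A" .
  with AX show ?thesis
    using X(2) Y(2) by (metis matrix_mul_assoc)
qed

lemma is_pseudoinverse_exists:
  fixes A :: "real^'m^'n"
  shows "\<exists>X. is_pseudoinverse A X"
proof -
  define T where "T = transpose A"
  let ?R = "range ((*v) T)"
  have inn: "(T *v w) \<bullet> x = w \<bullet> (A *v x)" for w x
    by (simp add: dot_lmul_matrix T_def)
  have inn': "x \<bullet> (T *v w) = (A *v x) \<bullet> w" for w x
    by (metis inn inner_commute)
  have subR: "subspace ?R"
    by (intro linear_subspace_image) auto
  have subA: "subspace (range ((*v) A))"
    by (intro linear_subspace_image) auto
  have ker: "d = 0" if d: "d \<in> ?R" and Td: "T *v (A *v d) = 0" for d
  proof -
    obtain w where w: "d = T *v w" using d by blast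
    have "(A *v d) \<bullet> (A *v d) = 0" using inn[of "A *v d" d] Td by simp
    then have "A *v d = 0" by simp
    then have "d \<bullet> d = 0" using inn[of w d] w by simp
    then show ?thesis by simp
  qed
  have ex: "\<exists>x\<in>?R. T *v (A *v x) = T *v y" for y
  proof -
    obtain p q where pq: "p \<in> span (range ((*v) A))"
        "\<And>w. w \<in> span (range ((*v) A)) \<Longrightarrow> orthogonal q w" "y = p + q"
      using orthogonal_subspace_decomp_exists[of "range ((*v) A)" y] by metis
    obtain x0 where x0: "p = A *v x0" using pq(1) subA by (metis rangeE span_eq_iff)
    have "(T *v q) \<bullet> (T *v q) = q \<bullet> (A *v (T *v q))" by (rule inn)
    also have "\<dots> = 0" using pq(2) by (simp add: span_base orthogonal_def)
    finally have q: "T *v q = 0" by simp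
    obtain x r where xr: "x \<in> span ?R" "\<And>w. w \<in> span ?R \<Longrightarrow> orthogonal r w" "x0 = x + r"
      using orthogonal_subspace_decomp_exists[of ?R x0] by metis
    have "(A *v r) \<bullet> (A *v r) = r \<bullet> (T *v (A *v r))" by (rule inn'[symmetric])
    also have "\<dots> = 0" using xr(2) by (simp add: span_base orthogonal_def)
    finally have r: "A *v r = 0" by simp
    have "x \<in> ?R" using xr(1) subR by (metis span_eq_iff)
    moreover have "T *v (A *v x) = T *v y"
      using pq(3) x0 xr(3) q r by (simp add: matrix_vector_right_distrib)
    ultimately show ?thesis by blast
  qed
  then obtain f where fR: "\<And>y. f y \<in> ?R" and fT: "\<And>y. T *v (A *v f y) = T *v y"
    by metis
  have uniq: "x = x'" if "x \<in> ?R" "x' \<in> ?R" "T *v (A *v x) = T *v (A *v x')" for x x'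
    using ker[of "x - x'"] that subspace_diff[OF subR]
    by (simp add: matrix_vector_mult_diff_distrib)
  have lin: "linear f"
  proof (rule linearI)
    show "f (a + b) = f a + f b" for a b
      by (rule uniq) (simp_all only: fR fT matrix_vector_right_distrib subspace_add[OF subR])
    show "f (c *\<^sub>R a) = c *\<^sub>R f a" for c a
      by (rule uniq) (simp_all only: fR fT matrix_vector_mult_scaleR subspace_scale[OF subR])
  qed
  define X where "X = matrix f"
  have X: "X *v y = f y" for y by (simp add: X_def matrix_works lin)
  have AfA: "A *v f (A *v x) = A *v x" for x
  proof -
    let ?d = "f (A *v x) - x"
    have z: "T *v (A *v ?d) = 0"
      by (simp only: matrix_vector_mult_diff_distrib fT) simp
    have "(A *v ?d) \<bullet> (A *v ?d) = ?d \<bullet> (T *v (A *v ?d))" by (rule inn'[symmetric])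
    then have "A *v ?d = 0" by (simp only: z) simp
    then show ?thesis by (simp add: matrix_vector_mult_diff_distrib)
  qed
  have fAf: "f (A *v f y) = f y" for y
    by (rule uniq) (simp_all only: fR fT)
  have sym1: "(A *v f y) \<bullet> z = (A *v f y) \<bullet> (A *v f z)" for y z
  proof -
    have "(A *v f y) \<bullet> (z - A *v f z) = f y \<bullet> (T *v (z - A *v f z))" by (rule inn'[symmetric])
    also have "T *v (z - A *v f z) = 0" by (simp only: matrix_vector_mult_diff_distrib fT) simp
    finally show ?thesis by (simp add: inner_diff_right)
  qed
  have sym2: "f y \<bullet> z = f y \<bullet> f (A *v z)" for y z
  proof -
    obtain w where "f y = T *v w" using fR[of y] by blast
    then have "f y \<bullet> (z - f (A *v z)) = w \<bullet> (A *v (z - f (A *v z)))" using inn by simp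
    also have "\<dots> = 0" by (simp add: matrix_vector_mult_diff_distrib AfA)
    finally show ?thesis by (simp add: inner_diff_right)
  qed
  have symI: "transpose M = M" if "\<And>y z. (M *v y) \<bullet> z = y \<bullet> (M *v z)" for M :: "real^'k^'k"
  proof -
    have "(transpose M *v y) \<bullet> z = (M *v y) \<bullet> z" for y z
      using that by (simp add: dot_lmul_matrix T_def)
    then show ?thesis by (metis matrix_eq vector_eq_rdot)
  qed
  have "A ** X ** A = A" "X ** A ** X = X"
    by (simp_all add: matrix_eq X AfA fAf flip: matrix_vector_mul_assoc)
  moreover have "transpose (A ** X) = A ** X"
    by (rule symI) (metis X inner_commute matrix_vector_mul_assoc sym1)
  moreover have "transpose (X ** A) = X ** A"
    by (rule symI) (metis X inner_commute matrix_vector_mul_assoc sym2)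
  ultimately show ?thesis unfolding is_pseudoinverse_def by blast
qed

lemma is_pseudoinverse_pseudoinverse: "is_pseudoinverse A (pseudoinverse A)"
  unfolding pseudoinverse_def
  by (rule theI') (metis is_pseudoinverse_exists is_pseudoinverse_unique)

definition sdeim :: "real^'m^'N \<Rightarrow> real^'n^'N \<Rightarrow> real^'N \<Rightarrow> real^'m \<Rightarrow> real^'N" where
  "sdeim \<Phi> S u z =
     (\<Phi> ** pseudoinverse (transpose S ** \<Phi>) ** transpose S) *v u + \<Phi> *v z"

definition best_approx :: "real^'m^'N \<Rightarrow> real^'N \<Rightarrow> real^'N" where
  "best_approx \<Phi> u = (\<Phi> ** transpose \<Phi>) *v u"

definition truncation_error :: "real^'m^'N \<Rightarrow> real^'N \<Rightarrow> real" where
  "truncation_error \<Phi> u = norm (best_approx \<Phi> u - u)"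

definition optimal_kernel_vector :: "real^'m^'N \<Rightarrow> real^'k^'m \<Rightarrow> real^'N \<Rightarrow> real^'m" where
  "optimal_kernel_vector \<Phi> Z u = (Z ** transpose Z ** transpose \<Phi>) *v u"

end

theory Submission
  imports Defs
begin

text \<open>
  Write \<open>A = S\<^sup>T\<Phi>\<close>, \<open>a = \<Phi>\<^sup>Tu\<close> and \<open>r = u - \<Phi>a\<close>, so that \<open>r\<close> is orthogonal to the range of \<open>\<Phi>\<close>
  and its length is the truncation error. Since \<open>I - A\<^sup>+A\<close> and \<open>ZZ\<^sup>T\<close> are both the orthogonal
  projection onto the kernel of \<open>A\<close> (\<open>kernel_projection\<close>), \<open>A\<^sup>+Aa - a\<close> is minus the optimal kernel
  vector. With \<open>D = \<Phi>A\<^sup>+S\<^sup>T\<close> the error of the reconstruction therefore splits as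
  \<open>\<Phi>(z - ZZ\<^sup>Ta) + (Dr - r)\<close>. The first term has the norm of \<open>z - ZZ\<^sup>Ta\<close>, because \<open>\<Phi>\<close> is an isometry.

  It remains to bound the second term by \<open>\<parallel>A\<^sup>+\<parallel> \<parallel>r\<parallel>\<close>, with no additional \<open>\<parallel>r\<parallel>\<close> as the triangle
  inequality would give. The matrix \<open>D\<close> is an oblique projection with \<open>\<parallel>D\<parallel> \<le> \<parallel>A\<^sup>+\<parallel>\<close>, and a
  projection and its complement have the same norm unless one of them vanishes. The instance
  needed here has \<open>r\<close> orthogonal to \<open>Dr\<close> (\<open>norm_diff_oblique_projection\<close>). The
  exceptional case \<open>Dr = 0\<close> is covered by \<open>\<parallel>A\<^sup>+\<parallel> \<ge> 1\<close>, which holds because \<open>A\<close> is a nonzero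
  contraction (\<open>spectral_norm_pseudoinverse_ge_1\<close>).
\<close>

lemma inner_transpose:
  fixes M :: "real^'m^'n"
  shows "x \<bullet> (transpose M *v y) = (M *v x) \<bullet> y"
  by (metis dot_lmul_matrix inner_commute transpose_matrix_vector)

lemma norm_mult_le_spectral_norm:
  fixes M :: "real^'m^'n"
  shows "norm (M *v x) \<le> spectral_norm M * norm x"
  unfolding spectral_norm_def by (rule onorm) (rule matrix_vector_mul_bounded_linear)

lemma transpose_mult_basis_matrix:
  assumes "basis_matrix M"
  shows "transpose M *v (M *v x) = x"
  using assms by (simp add: basis_matrix_def matrix_vector_mul_assoc del: transpose_matrix_vector)

lemma norm_basis_matrix_mult:
  assumes "basis_matrix M"
  shows "norm (M *v x) = norm x"
  unfolding norm_eq_sqrt_inner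
  by (metis assms inner_transpose transpose_mult_basis_matrix)

text \<open>By Cauchy--Schwarz, since \<open>\<parallel>M\<^sup>Ty\<parallel>\<^sup>2 = MM\<^sup>Ty \<bullet> y\<close> and \<open>M\<close> is an isometry.\<close>

lemma norm_transpose_basis_matrix_mult_le:
  fixes M :: "real^'m^'n"
  assumes "basis_matrix M"
  shows "norm (transpose M *v y) \<le> norm y"
proof -
  let ?t = "transpose M *v y"
  have "norm ?t * norm ?t = (M *v ?t) \<bullet> y"
    by (metis inner_transpose norm_eq_square norm_ge_zero power2_eq_square power2_norm_eq_inner)
  also have "\<dots> \<le> norm ?t * norm y"
    by (metis assms norm_basis_matrix_mult norm_cauchy_schwarz)
  finally show ?thesis
    by (metis mult_le_cancel_left norm_ge_zero order_le_less order_trans)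
qed

lemma basis_matrixI_columns:
  fixes M :: "real^'m^'n"
  assumes "\<And>i j. column i M \<bullet> column j M = (if i = j then 1 else 0)"
  shows "basis_matrix M"
proof -
  have "(transpose M ** M) $ i $ j = column i M \<bullet> column j M" for i j
    by (simp add: matrix_matrix_mult_def transpose_def column_def inner_vec_def)
  then show ?thesis
    using assms by (simp add: basis_matrix_def vec_eq_iff mat_def)
qed

lemma basis_matrix_selection_matrix:
  assumes "selection_matrix S"
  shows "basis_matrix S"
  using assms unfolding selection_matrix_def
  by (auto intro!: basis_matrixI_columns simp: inner_axis_axis dest: injD)

lemma basis_matrix_kernel_matrix:
  assumes "kernel_matrix A Z"
  shows "basis_matrix Z"
  using assms by (intro basis_matrixI_columns) (simp add: kernel_matrix_def)

lemma range_kernel_matrix: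
  fixes Z :: "real^'k^'m"
  assumes "kernel_matrix A Z"
  shows "range ((*v) Z) = null_space A"
proof
  show "range ((*v) Z) \<subseteq> null_space A"
    using assms matrix_vector_mult_in_columnspace[of Z] by (auto simp: kernel_matrix_def)
  have "columns Z \<subseteq> range ((*v) Z)"
    by (auto simp: columns_image_basis)
  then have "span (columns Z) \<subseteq> range ((*v) Z)"
    by (intro span_minimal linear_subspace_image) auto
  then show "null_space A \<subseteq> range ((*v) Z)"
    using assms by (simp add: kernel_matrix_def)
qed

text \<open>Both \<open>ZZ\<^sup>T\<close> and \<open>I - A\<^sup>+A\<close> project orthogonally onto the kernel of \<open>A\<close>. Concretely,
  \<open>a - A\<^sup>+Aa\<close> lies in the kernel, hence is fixed by \<open>ZZ\<^sup>T\<close>, and \<open>Z\<^sup>TA\<^sup>+A = (A\<^sup>+AZ)\<^sup>T = 0\<close> by symmetry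
  of \<open>A\<^sup>+A\<close>.\<close>

lemma kernel_projection:
  fixes A :: "real^'m^'n" and Z :: "real^'k^'m"
  assumes Z: "kernel_matrix A Z"
  shows "Z *v (transpose Z *v a) = a - pseudoinverse A *v (A *v a)"
proof -
  define P where "P = pseudoinverse A"
  have APA: "A ** P ** A = A" and sym: "transpose (P ** A) = P ** A"
    using is_pseudoinverse_pseudoinverse[of A] by (auto simp: is_pseudoinverse_def P_def)
  let ?b = "a - P *v (A *v a)"
  have "A *v ?b = 0"
    using APA by (simp add: matrix_vector_mult_diff_distrib matrix_vector_mul_assoc matrix_mul_assoc)
  then obtain c where c: "?b = Z *v c"
    using range_kernel_matrix[OF Z] by (auto simp: null_space_def)
  have AZ: "A *v (Z *v x) = 0" for x
    using range_kernel_matrix[OF Z] by (auto simp: null_space_def)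
  have "x \<bullet> (transpose Z *v (P *v (A *v a))) = 0" for x
  proof -
    have "x \<bullet> (transpose Z *v (P *v (A *v a))) = (Z *v x) \<bullet> (transpose (P ** A) *v a)"
      by (simp only: inner_transpose sym matrix_vector_mul_assoc[of P])
    also have "\<dots> = (P *v (A *v (Z *v x))) \<bullet> a"
      by (simp only: inner_transpose matrix_vector_mul_assoc[of P])
    finally show ?thesis by (simp add: AZ)
  qed
  then have "transpose Z *v (P *v (A *v a)) = 0"
    by (metis inner_eq_zero_iff)
  then have "transpose Z *v a = transpose Z *v ?b"
    by (simp only: matrix_vector_mult_diff_distrib diff_zero)
  also have "\<dots> = c"
    unfolding c by (rule transpose_mult_basis_matrix[OF basis_matrix_kernel_matrix[OF Z]])
  finally show ?thesis
    using c by (simp only: P_def)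
qed

text \<open>On the range of \<open>A\<close> the map \<open>A\<close> undoes \<open>A\<^sup>+\<close>, so \<open>A\<^sup>+\<close> cannot shrink those vectors when
  \<open>A\<close> does not enlarge any.\<close>

lemma spectral_norm_pseudoinverse_ge_1:
  fixes A :: "real^'m^'n"
  assumes "A \<noteq> 0" and contr: "\<And>x. norm (A *v x) \<le> norm x"
  shows "1 \<le> spectral_norm (pseudoinverse A)"
proof -
  obtain x where x: "A *v x \<noteq> 0"
    using \<open>A \<noteq> 0\<close> by (metis matrix_eq matrix_vector_mult_0)
  have "norm (A *v x) = norm (A *v (pseudoinverse A *v (A *v x)))"
    using is_pseudoinverse_pseudoinverse[of A]
    by (simp add: is_pseudoinverse_def matrix_vector_mul_assoc matrix_mul_assoc)
  also have "\<dots> \<le> norm (pseudoinverse A *v (A *v x))"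
    by (rule contr)
  also have "\<dots> \<le> spectral_norm (pseudoinverse A) * norm (A *v x)"
    by (rule norm_mult_le_spectral_norm)
  finally show ?thesis
    using x by simp
qed

text \<open>Let \<open>w = Dr\<close> and \<open>y = r - w\<close>. As \<open>Dy = 0\<close>, the map \<open>D\<close> sends the whole line \<open>w + sy\<close> to \<open>w\<close>,
  and the point of that line closest to the origin gives the best lower bound on \<open>K\<close>. Because
  \<open>r \<bullet> w = 0\<close>, that point has norm \<open>\<parallel>w\<parallel> \<parallel>r\<parallel> / \<parallel>y\<parallel>\<close>, whence \<open>\<parallel>y\<parallel> \<le> K \<parallel>r\<parallel>\<close> if \<open>w \<noteq> 0\<close>. For \<open>w = 0\<close> the
  claim is \<open>\<parallel>r\<parallel> \<le> K \<parallel>r\<parallel>\<close>, which is where \<open>1 \<le> K\<close> enters.\<close>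

lemma norm_diff_oblique_projection:
  fixes D :: "'a::real_inner \<Rightarrow> 'a"
  assumes "linear D" and idem: "\<And>x. D (D x) = D x"
    and bound: "\<And>x. norm (D x) \<le> K * norm x" and "1 \<le> K"
    and orth: "r \<bullet> D r = 0"
  shows "norm (r - D r) \<le> K * norm r"
proof (cases "D r = 0")
  case True
  then show ?thesis
    using \<open>1 \<le> K\<close> mult_right_mono[of 1 K "norm r"] by simp
next
  case False
  define w where "w = D r"
  define y where "y = r - w"
  have w: "norm w > 0" using False by (simp add: w_def)
  have rw: "r \<bullet> w = 0" "w \<bullet> r = 0" using orth by (simp_all add: w_def inner_commute)
  have y2: "(norm y)\<^sup>2 = (norm r)\<^sup>2 + (norm w)\<^sup>2"
    unfolding y_def power2_norm_eq_inner by (simp add: inner_diff rw)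
  then have y: "norm y > 0"
    using w by (smt (verit) norm_ge_zero zero_less_power zero_le_power2 power2_eq_square mult_eq_0_iff)
  \<comment> \<open>The closest point \<open>w + (\<parallel>w\<parallel>\<^sup>2 / \<parallel>y\<parallel>\<^sup>2) y\<close>, multiplied by \<open>\<parallel>y\<parallel>\<^sup>2\<close>.\<close>
  define x where "x = (norm r)\<^sup>2 *\<^sub>R w + (norm w)\<^sup>2 *\<^sub>R r"
  have "D x = (norm y)\<^sup>2 *\<^sub>R w"
    unfolding x_def y2 using \<open>linear D\<close> idem[of r]
    by (simp add: linear_add linear_scale w_def scaleR_left_distrib)
  then have nDx: "norm (D x) = (norm y)\<^sup>2 * norm w" by simp
  have "(norm x)\<^sup>2 = (norm r * norm w * norm y)\<^sup>2"
  proof -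
    have "(norm x)\<^sup>2 = ((norm r)\<^sup>2)\<^sup>2 * (norm w)\<^sup>2 + ((norm w)\<^sup>2)\<^sup>2 * (norm r)\<^sup>2"
      unfolding x_def power2_norm_eq_inner
      by (simp add: inner_add rw power2_eq_square algebra_simps)
    also have "\<dots> = (norm r * norm w)\<^sup>2 * (norm y)\<^sup>2"
      unfolding y2 by (simp add: power2_eq_square algebra_simps)
    finally show ?thesis by (simp only: power_mult_distrib)
  qed
  then have nx: "norm x = norm r * norm w * norm y"
    by (rule power2_eq_imp_eq) simp_all
  have "norm y * (norm y * norm w) \<le> (K * norm r) * (norm y * norm w)"
    using bound[of x] unfolding nDx nx by (simp add: power2_eq_square ac_simps)
  then have "norm y \<le> K * norm r"
    using y w by (simp only: mult_le_cancel_right) (simp add: zero_less_mult_iff)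
  then show ?thesis by (simp add: y_def w_def)
qed

theorem corollary3:
  fixes \<Phi> :: "real^'m^'N" and S :: "real^'n^'N" and Z :: "real^'k^'m" and u :: "real^'N"
  assumes "1 \<le> CARD('n)" and "CARD('n) < CARD('m)" and "CARD('m) \<le> CARD('N)"
    and "CARD('k) = CARD('m) - CARD('n)"
    and "basis_matrix \<Phi>"
    and "selection_matrix S"
    and "rank (transpose S ** \<Phi>) = CARD('n)"
    and "kernel_matrix (transpose S ** \<Phi>) Z"
  shows "\<forall>z \<in> null_space (transpose S ** \<Phi>).
    norm (sdeim \<Phi> S u z - u)
      \<le> spectral_norm (pseudoinverse (transpose S ** \<Phi>)) * truncation_error \<Phi> u
        + norm (z - optimal_kernel_vector \<Phi> Z u)"
proof
  fix z
  define A where "A = transpose S ** \<Phi>"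
  define P where "P = pseudoinverse A"
  define K where "K = spectral_norm P"
  define a where "a = transpose \<Phi> *v u"
  define r where "r = u - \<Phi> *v a"
  define D where "D = (\<lambda>x. \<Phi> *v (P *v (transpose S *v x)))"
  define zhat where "zhat = optimal_kernel_vector \<Phi> Z u"
  have \<Phi>: "basis_matrix \<Phi>" by fact
  have S: "basis_matrix S" by (rule basis_matrix_selection_matrix) fact
  have A_mult: "A *v x = transpose S *v (\<Phi> *v x)" for x
    by (simp only: A_def matrix_vector_mul_assoc)
  have PAP: "P *v (A *v (P *v x)) = P *v x" for x
    using is_pseudoinverse_pseudoinverse[of A]
    by (simp add: is_pseudoinverse_def P_def matrix_vector_mul_assoc matrix_mul_assoc)

  have "1 \<le> K"
    unfolding K_def P_def
  proof (rule spectral_norm_pseudoinverse_ge_1)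
    show "A \<noteq> 0"
      using assms(1,7) by (auto simp: A_def)
    show "norm (A *v x) \<le> norm x" for x
      by (metis A_mult S \<Phi> norm_basis_matrix_mult norm_transpose_basis_matrix_mult_le)
  qed
  have D_bound: "norm (D x) \<le> K * norm x" for x
  proof -
    have "norm (D x) \<le> K * norm (transpose S *v x)"
      by (simp only: D_def norm_basis_matrix_mult[OF \<Phi>] K_def norm_mult_le_spectral_norm)
    also have "\<dots> \<le> K * norm x"
      using \<open>1 \<le> K\<close> norm_transpose_basis_matrix_mult_le[OF S] by (intro mult_left_mono) auto
    finally show ?thesis .
  qed
  have D_idem: "D (D x) = D x" for x
    by (simp only: D_def PAP flip: A_mult)
  have D_linear: "linear D"
    unfolding D_def
    by (intro linearI)
       (simp_all only: matrix_vector_right_distrib matrix_vector_mult_scaleR)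
  have "transpose \<Phi> *v r = 0"
    by (simp only: r_def a_def matrix_vector_mult_diff_distrib transpose_mult_basis_matrix[OF \<Phi>]
        diff_self)
  then have "r \<bullet> D r = 0"
    unfolding D_def by (metis inner_commute inner_transpose inner_zero_right)
  with D_linear D_idem D_bound \<open>1 \<le> K\<close> have Dr: "norm (r - D r) \<le> K * norm r"
    by (rule norm_diff_oblique_projection)

  have "zhat = Z *v (transpose Z *v a)"
    by (simp only: zhat_def optimal_kernel_vector_def a_def matrix_vector_mul_assoc matrix_mul_assoc)
  also have "\<dots> = a - P *v (A *v a)"
    unfolding P_def by (rule kernel_projection) (use assms(8) in \<open>simp add: A_def\<close>)
  finally have zhat: "P *v (A *v a) = a - zhat" by simp
  have u: "u = \<Phi> *v a + r" by (simp add: r_def)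
  have "sdeim \<Phi> S u z = D u + \<Phi> *v z"
    by (simp only: sdeim_def D_def P_def A_def matrix_vector_mul_assoc matrix_mul_assoc)
  also have "D u = \<Phi> *v (P *v (A *v a)) + D r"
    unfolding u linear_add[OF D_linear] by (simp only: D_def A_mult)
  also have "\<Phi> *v (P *v (A *v a)) = \<Phi> *v a - \<Phi> *v zhat"
    by (simp only: zhat matrix_vector_mult_diff_distrib)
  finally have "sdeim \<Phi> S u z - u = \<Phi> *v (z - zhat) - (r - D r)"
    by (simp add: r_def matrix_vector_mult_diff_distrib)
  then have "norm (sdeim \<Phi> S u z - u) \<le> norm (z - zhat) + norm (r - D r)"
    by (metis \<Phi> norm_basis_matrix_mult norm_triangle_ineq4)
  moreover have "truncation_error \<Phi> u = norm r"
    by (simp only: truncation_error_def best_approx_def r_def a_def matrix_vector_mul_assoc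
        norm_minus_commute)
  ultimately show "norm (sdeim \<Phi> S u z - u)
      \<le> spectral_norm (pseudoinverse (transpose S ** \<Phi>)) * truncation_error \<Phi> u
        + norm (z - optimal_kernel_vector \<Phi> Z u)"
    using Dr by (simp add: K_def P_def A_def zhat_def)
qed

end
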